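(* Let $K\subset\mathbb{R}^n$ be a convex body in Löwner position. Let $\nu$ be any finite positive non-zero (Borel) measure on $S^{n-1}\cap\partial K$, and let $F:\mathbb{R}\to\mathbb{R}$ be any $C^1$ function that is non-negative, non-decreasing, convex, strictly convex in $[0,\infty)$, and satisfies $F'(0)>0$. Consider the convex functional $I_\nu:\mathrm{Sym}\times\mathbb{R}^n\to\mathbb{R}$ defined by $$I_\nu(M,w)=\int_{S^{n-1}}F(\langle \xi, M\xi+w\rangle)\,d\nu(\xi).$$ If the restriction of $I_\nu$ to $\mathrm{Sym}_0\times\mathbb{R}^n$ has a unique global minimum $(M_0,w_0)$, then the measure $$F'(\langle \xi, M_0\xi+w_0\rangle)\,d\nu(\xi)$$ is non-negative, non-zero, centered and isotropic.
   Context: A convex body is a compact convex subset of $\mathbb{R}^n$ with non-empty interior. $\mathbb{B}$ is the closed unit Euclidean ball of $\mathbb{R}^n$ and $S^{n-1}$ its boundary. A convex body $K$ is in Löwner position if $\mathbb{B}$ is the (unique) ellipsoid of minimal volume containing $K$. $\mathrm{Sym}$ is the space of real symmetric $n\times n$ matrices and $\mathrm{Sym}_0=\{A\in\mathrm{Sym}: \mathrm{tr}(A)=0\}$. A measure on $S^{n-1}\cap\partial K$ is regarded as a measure on $S^{n-1}$ concentrated on $S^{n-1}\cap\partial K$. For vectors $v,w$, $v\otimes w$ is the matrix $(v\otimes w)_{i,j}=v_iw_j$. A measure $\mu$ on $S^{n-1}$ is isotropic if $\int_{S^{n-1}}\xi\otimes\xi\,d\mu=\lambda\,\mathrm{Id}$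 for some $\lambda\ne0$, and centered if $\int_{S^{n-1}}\xi\,d\mu=0$ (integrals taken coordinatewise). *)

theory Defs
  imports "HOL-Analysis.Analysis"
begin

definition convex_body :: "(real ^ 'n) set \<Rightarrow> bool" where
  "convex_body K \<longleftrightarrow> compact K \<and> convex K \<and> interior K \<noteq> {}"

definition ellipsoid :: "(real ^ 'n) set \<Rightarrow> bool" where
  "ellipsoid E \<longleftrightarrow> (\<exists>(A :: real ^ 'n ^ 'n) c. invertible A \<and> E = (\<lambda>x. A *v x + c) ` cball 0 1)"

definition lowner_position :: "(real ^ 'n) set \<Rightarrow> bool" where
  "lowner_position K \<longleftrightarrow>
     (\<forall>E. is_arg_min (measure lebesgue) (\<lambda>E. ellipsoid E \<and> K \<subseteq> E) E \<longleftrightarrow> E = cball 0 1)"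

definition Sym :: "(real ^ 'n ^ 'n) set" where
  "Sym = {A. transpose A = A}"

definition Sym0 :: "(real ^ 'n ^ 'n) set" where
  "Sym0 = {A \<in> Sym. trace A = 0}"

text \<open>The measures in question live on the unit sphere, i.e. their \<sigma>-algebra is the Borel
  \<sigma>-algebra of the sphere and not that of the whole space.\<close>

definition sphere_borel :: "(real ^ 'n) measure" where
  "sphere_borel = restrict_space borel (sphere 0 1)"

definition tensor :: "real ^ 'n \<Rightarrow> real ^ 'n \<Rightarrow> real ^ 'n ^ 'n" where
  "tensor v w = (\<chi> i j. v $ i * w $ j)"

text \<open>Since the Bochner integral of a non-integrable function is \<open>0\<close> by convention,
  \<open>has_bochner_integral\<close> is used so that integrability is part of both notions.\<close>

definition isotropic :: "(real ^ 'n) measure \<Rightarrow> bool" where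
  "isotropic \<mu> \<longleftrightarrow>
     (\<exists>c::real. c \<noteq> 0 \<and>
       (\<forall>i j. has_bochner_integral \<mu> (\<lambda>\<xi>. tensor \<xi> \<xi> $ i $ j)
                ((c *\<^sub>R (mat 1 :: real ^ 'n ^ 'n)) $ i $ j)))"

definition centered :: "(real ^ 'n) measure \<Rightarrow> bool" where
  "centered \<mu> \<longleftrightarrow> (\<forall>i. has_bochner_integral \<mu> (\<lambda>\<xi>. \<xi> $ i) 0)"

definition strictly_convex_on :: "real set \<Rightarrow> (real \<Rightarrow> real) \<Rightarrow> bool" where
  "strictly_convex_on S F \<longleftrightarrow> convex S \<and>
     (\<forall>x\<in>S. \<forall>y\<in>S. \<forall>u>0. \<forall>v>0. x \<noteq> y \<longrightarrow> u + v = 1 \<longrightarrow>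
        F (u * x + v * y) < u * F x + v * F y)"

definition I_fun ::
  "(real \<Rightarrow> real) \<Rightarrow> (real ^ 'n) measure \<Rightarrow> (real ^ 'n ^ 'n) \<times> (real ^ 'n) \<Rightarrow> real" where
  "I_fun F \<nu> = (\<lambda>(M, w). LINT \<xi>|\<nu>. F (\<xi> \<bullet> (M *v \<xi> + w)))"

text \<open>For the admissible data the integrand is integrable and the functional is convex.\<close>

lemma I_fun_integrable:
  fixes \<nu> :: "(real ^ 'n) measure"
  assumes "finite_measure \<nu>" "sets \<nu> = sets sphere_borel" "continuous_on UNIV F"
  shows "integrable \<nu> (\<lambda>\<xi>. F (\<xi> \<bullet> (M *v \<xi> + w)) :: real)"
proof -
  interpret finite_measure \<nu> by fact
  let ?g = "\<lambda>\<xi>. F (\<xi> \<bullet> (M *v \<xi> + w))"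
  have sp: "space \<nu> = sphere 0 1"
    using sets_eq_imp_space_eq[OF assms(2)] by (simp add: sphere_borel_def space_restrict_space)
  have cont: "continuous_on UNIV ?g"
    by (rule continuous_on_compose2[OF assms(3)])
       (intro continuous_intros linear_continuous_on matrix_vector_mul_bounded_linear, simp)
  have "bounded (?g ` sphere 0 1)"
    by (intro compact_imp_bounded compact_continuous_image continuous_on_subset[OF cont]) auto
  then obtain B where B: "\<And>\<xi>. \<xi> \<in> sphere 0 1 \<Longrightarrow> norm (?g \<xi>) \<le> B"
    unfolding bounded_iff by blast
  have "?g \<in> borel_measurable sphere_borel"
    unfolding sphere_borel_def
    by (intro measurable_restrict_space1 borel_measurable_continuous_onI cont)
  then have "?g \<in> borel_measurable \<nu>"
    using measurable_cong_sets[OF assms(2) refl] by blast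
  then show ?thesis
    using B by (intro integrable_const_bound[where B = B]) (auto simp: sp)
qed

lemma I_fun_convex:
  fixes \<nu> :: "(real ^ 'n) measure"
  assumes "finite_measure \<nu>" "sets \<nu> = sets sphere_borel" "continuous_on UNIV F" "convex_on UNIV F"
  shows "convex_on (Sym \<times> UNIV) (I_fun F \<nu>)"
proof -
  note int = I_fun_integrable[OF assms(1-3)]
  have "convex (Sym :: (real ^ 'n ^ 'n) set)"
    by (auto simp: convex_def Sym_def transpose_def vec_eq_iff)
  moreover have "I_fun F \<nu> (u *\<^sub>R x + v *\<^sub>R y) \<le> u * I_fun F \<nu> x + v * I_fun F \<nu> y"
    if "u \<ge> 0" "v \<ge> 0" "u + v = 1" for x y u v
  proof -
    obtain M w N z where xy: "x = (M, w)" "y = (N, z)" by (cases x, cases y)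
    have eq: "\<xi> \<bullet> ((u *\<^sub>R M + v *\<^sub>R N) *v \<xi> + (u *\<^sub>R w + v *\<^sub>R z))
        = u * (\<xi> \<bullet> (M *v \<xi> + w)) + v * (\<xi> \<bullet> (N *v \<xi> + z))" for \<xi>
      by (simp add: matrix_vector_mult_add_rdistrib scaleR_matrix_vector_assoc[symmetric]
          inner_add_right algebra_simps)
    have "(LINT \<xi>|\<nu>. F (\<xi> \<bullet> ((u *\<^sub>R M + v *\<^sub>R N) *v \<xi> + (u *\<^sub>R w + v *\<^sub>R z))))
        \<le> (LINT \<xi>|\<nu>. u * F (\<xi> \<bullet> (M *v \<xi> + w)) + v * F (\<xi> \<bullet> (N *v \<xi> + z)))"
    proof (rule integral_mono)
      show "F (\<xi> \<bullet> ((u *\<^sub>R M + v *\<^sub>R N) *v \<xi> + (u *\<^sub>R w + v *\<^sub>R z)))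
          \<le> u * F (\<xi> \<bullet> (M *v \<xi> + w)) + v * F (\<xi> \<bullet> (N *v \<xi> + z))" for \<xi>
        using assms(4) that unfolding eq convex_on_def by auto
    qed (intro int Bochner_Integration.integrable_add integrable_mult_right)+
    then show ?thesis
      by (simp add: xy I_fun_def int)
  qed
  ultimately show ?thesis
    unfolding convex_on_def by (auto intro: convex_Times)
qed

end

theory Submission
  imports Defs
begin

text \<open>
  Write \<open>\<ell>\<^sub>p(\<xi>) = \<xi> \<bullet> (M *v \<xi> + w)\<close> for \<open>p = (M, w)\<close>; it is linear in \<open>p\<close>, and the density in question is
  \<open>g = F' \<circ> \<ell>\<^sub>p\<close> at the minimum \<open>p = (M0, w0)\<close>. The theorem is the Euler--Lagrange equation of \<open>I_fun F \<nu>\<close>: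
  the derivative at the minimum vanishes in every direction \<open>(H, v)\<close> of the linear space
  \<open>Sym0 \<times> UNIV\<close>, that is,

  \<open>\<integral> g(\<xi>) (\<xi> \<bullet> (H *v \<xi> + v)) d\<nu>(\<xi>) = 0\<close>.

  Directions with \<open>H = 0\<close> give centeredness. Directions with \<open>v = 0\<close> say that the matrix
  \<open>T = \<integral> g(\<xi>) \<xi> \<otimes> \<xi> d\<nu>(\<xi>)\<close> is orthogonal to all traceless symmetric matrices; since \<open>T\<close> is itself
  symmetric, it is a multiple \<open>c Id\<close>. Taking traces, \<open>n c = \<integral> g d\<nu>\<close>, so what is left for
  isotropy is that \<open>g\<close> does not vanish \<open>\<nu>\<close>-almost everywhere.

  This is where uniqueness of the minimum enters. As \<open>F'\<close> is non-decreasing and \<open>F' 0 > 0\<close>, a zero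
  of \<open>F'\<close> is negative and \<open>F\<close> is constant to the left of it. If \<open>g = 0\<close> almost everywhere, then
  doubling \<open>(M0, w0)\<close>, which moves the argument \<open>\<ell>\<^sub>p(\<xi>)\<close> further to the left, does not change the
  value of the functional. By uniqueness \<open>(M0, w0) = (0, 0)\<close>, so \<open>g\<close> is the positive constant
  \<open>F' 0\<close>, a contradiction to \<open>\<nu> \<noteq> 0\<close>.

  The derivative of \<open>I_fun F \<nu>\<close> is taken one-sidedly in
  \<open>integral_deriv_nonneg_of_convex_min\<close>, the Euler--Lagrange equation is
  \<open>euler_lagrange\<close>, and the non-vanishing of \<open>g\<close> is \<open>not_AE_deriv_zero\<close>.
\<close>

section \<open>Convex differentiable functions of one variable\<close>

lemma convex_above_tangent:
  fixes F :: "real \<Rightarrow> real"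
  assumes "convex_on UNIV F" "\<And>x. (F has_real_derivative F' x) (at x)"
  shows "F x + F' x * (y - x) \<le> F y"
  using convex_on_imp_above_tangent[OF assms(1) connected_UNIV, of x y "F' x"] assms(2)
  by (simp add: algebra_simps)

lemma convex_deriv_mono:
  fixes F :: "real \<Rightarrow> real"
  assumes "convex_on UNIV F" "\<And>x. (F has_real_derivative F' x) (at x)"
  shows "mono F'"
proof (rule monoI)
  fix x y :: real assume "x \<le> y"
  have "F x + F' x * (y - x) \<le> F y" "F y + F' y * (x - y) \<le> F x"
    using convex_above_tangent[OF assms] by blast+
  then have "0 \<le> (F' y - F' x) * (y - x)" by (simp add: algebra_simps)
  with \<open>x \<le> y\<close> show "F' x \<le> F' y"
    by (cases "x = y") (auto simp: zero_le_mult_iff)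
qed

text \<open>The tangent at a critical point bounds \<open>F\<close> from below, monotonicity bounds it from above.\<close>

lemma mono_convex_const_left_of_critical_point:
  fixes F :: "real \<Rightarrow> real"
  assumes "convex_on UNIV F" "\<And>x. (F has_real_derivative F' x) (at x)" "mono F"
    and "F' a = 0" "b \<le> a"
  shows "F b = F a"
  using convex_above_tangent[OF assms(1,2), of a b] monoD[OF assms(3,5)] assms(4) by simp

section \<open>The first variation of a convex integral functional\<close>

text \<open>
  By convexity the difference quotient in direction \<open>l\<close> at step \<open>t > 0\<close> is at most
  \<open>\<integral> F'(a + t l) l\<close>, the slope at the far end, so this integral is non-negative
  when \<open>a\<close> is a minimum in direction \<open>l\<close>. Let \<open>t\<close> tend to \<open>0\<close>:
  all arguments stay in a fixed bounded interval, on which the monotone function \<open>F'\<close> is bounded.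
\<close>

lemma integral_deriv_nonneg_of_convex_min:
  fixes F :: "real \<Rightarrow> real" and a l :: "'a \<Rightarrow> real"
  assumes "finite_measure \<nu>"
    and conv: "convex_on UNIV F"
    and der: "\<And>x. (F has_real_derivative F' x) (at x)"
    and cont: "continuous_on UNIV F'" and nonneg: "\<And>x. 0 \<le> F' x"
    and [measurable]: "a \<in> borel_measurable \<nu>" "l \<in> borel_measurable \<nu>"
    and a: "\<And>x. x \<in> space \<nu> \<Longrightarrow> \<bar>a x\<bar> \<le> A" and l: "\<And>x. x \<in> space \<nu> \<Longrightarrow> \<bar>l x\<bar> \<le> B"
    and int: "\<And>t. integrable \<nu> (\<lambda>x. F (a x + t * l x))"
    and min: "\<And>t. (LINT x|\<nu>. F (a x)) \<le> (LINT x|\<nu>. F (a x + t * l x))"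
  shows "0 \<le> (LINT x|\<nu>. F' (a x) * l x)"
proof -
  interpret finite_measure \<nu> by fact
  have [measurable]: "F' \<in> borel_measurable borel"
    using cont by (rule borel_measurable_continuous_onI)
  define C where "C = F' (A + B) * B"
  have bound: "\<bar>F' (a x + t * l x) * l x\<bar> \<le> C" if x: "x \<in> space \<nu>" and t: "0 \<le> t" "t \<le> 1" for x t
  proof -
    have "t * l x \<le> B"
      using mult_mono[OF t(2), of "l x" B] mult_nonneg_nonpos[OF t(1), of "l x"] l[OF x]
      by (cases "0 \<le> l x") (auto simp: mult_left_le_one_le)
    then have "F' (a x + t * l x) \<le> F' (A + B)"
      using a[OF x] by (intro monoD[OF convex_deriv_mono[OF conv der]]) linarith
    then show ?thesis
      unfolding C_def abs_mult using nonneg l[OF x] by (intro mult_mono) auto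
  qed
  have step: "0 \<le> (LINT x|\<nu>. F' (a x + t * l x) * l x)" if t: "0 < t" "t \<le> 1" for t
  proof -
    have intd: "integrable \<nu> (\<lambda>x. F' (a x + t * l x) * l x)"
      using bound t by (intro integrable_const_bound[where B = C]) auto
    have "0 \<le> (LINT x|\<nu>. F (a x + t * l x) - F (a x))"
      using min[of t] int[of t] int[of 0] by simp
    also have "\<dots> \<le> (LINT x|\<nu>. t * (F' (a x + t * l x) * l x))"
    proof (rule integral_mono)
      show "F (a x + t * l x) - F (a x) \<le> t * (F' (a x + t * l x) * l x)" for x
        using convex_above_tangent[OF conv der, of "a x + t * l x" "a x"] by (simp add: algebra_simps)
    qed (use int[of t] int[of 0] intd in auto)
    finally show ?thesis using t by (simp add: zero_le_mult_iff)
  qed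
  have "(\<lambda>n. LINT x|\<nu>. F' (a x + 1 / real (Suc n) * l x) * l x) \<longlonglongrightarrow> (LINT x|\<nu>. F' (a x) * l x)"
  proof (rule integral_dominated_convergence[where w = "\<lambda>_. C"])
    show "AE x in \<nu>. (\<lambda>n. F' (a x + 1 / real (Suc n) * l x) * l x) \<longlonglongrightarrow> F' (a x) * l x"
    proof (rule AE_I2)
      fix x
      have "(\<lambda>n. a x + 1 / real (Suc n) * l x) \<longlonglongrightarrow> a x + 0 * l x"
        by (intro tendsto_intros LIMSEQ_Suc[OF lim_1_over_n])
      then have "(\<lambda>n. F' (a x + 1 / real (Suc n) * l x)) \<longlonglongrightarrow> F' (a x)"
        using continuous_on_tendsto_compose[OF cont] by simp
      then show "(\<lambda>n. F' (a x + 1 / real (Suc n) * l x) * l x) \<longlonglongrightarrow> F' (a x) * l x"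
        by (intro tendsto_intros)
    qed
    show "AE x in \<nu>. norm (F' (a x + 1 / real (Suc n) * l x) * l x) \<le> C" for n
      using bound[of _ "1 / real (Suc n)"] by (intro AE_I2) (simp del: of_nat_Suc)
  qed auto
  then show ?thesis
    using step[of "1 / real (Suc n)" for n] by (intro LIMSEQ_le_const) (auto simp del: of_nat_Suc)
qed

section \<open>Rank-one matrices and the quadratic-affine form\<close>

lemma tensor_vector_mult: "tensor v w *v \<xi> = (w \<bullet> \<xi>) *\<^sub>R v"
  by (simp add: tensor_def matrix_vector_mult_def inner_vec_def vec_eq_iff sum_distrib_left mult_ac)

lemma trace_tensor: "trace (tensor v w) = v \<bullet> w"
  by (simp add: trace_def tensor_def inner_vec_def)

text \<open>
  These matrices span \<open>Sym0\<close>. A symmetric matrix orthogonal to the first family is diagonal, and one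
  orthogonal to the second has equal diagonal entries.
\<close>

lemma tensor_axis_Sym0:
  fixes i j :: "'n :: finite"
  shows "i \<noteq> j \<Longrightarrow> tensor (axis i 1) (axis j 1) + tensor (axis j 1) (axis i 1) \<in> (Sym0 :: (real ^ 'n ^ 'n) set)"
    and "tensor (axis i 1) (axis i 1) - tensor (axis j 1) (axis j 1) \<in> (Sym0 :: (real ^ 'n ^ 'n) set)"
  by (simp_all add: Sym0_def Sym_def trace_add trace_sub trace_tensor inner_axis_axis)
    (simp_all add: transpose_def tensor_def vec_eq_iff)

lemma subspace_Sym0: "subspace (Sym0 :: (real ^ 'n ^ 'n) set)"
  by (auto simp: subspace_def Sym0_def Sym_def transpose_def vec_eq_iff trace_def sum.distrib
      simp flip: sum_distrib_left)

lemma quad_add_scale: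
  fixes M H :: "real ^ 'n ^ 'n"
  shows "\<xi> \<bullet> ((M + t *\<^sub>R H) *v \<xi> + (w + t *\<^sub>R v)) = \<xi> \<bullet> (M *v \<xi> + w) + t * (\<xi> \<bullet> (H *v \<xi> + v))"
  by (simp add: matrix_vector_mult_add_rdistrib scaleR_matrix_vector_assoc[symmetric]
      inner_add_right algebra_simps)

lemma continuous_on_quad:
  fixes M :: "real ^ 'n ^ 'n"
  shows "continuous_on S (\<lambda>\<xi>. \<xi> \<bullet> (M *v \<xi> + w))"
  by (intro continuous_intros linear_continuous_on matrix_vector_mul_bounded_linear)

lemma quad_bounded_on_sphere:
  fixes M :: "real ^ 'n ^ 'n"
  obtains B where "\<And>\<xi>. \<xi> \<in> sphere 0 1 \<Longrightarrow> \<bar>\<xi> \<bullet> (M *v \<xi> + w)\<bar> \<le> B"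
proof -
  have "bounded ((\<lambda>\<xi>. \<xi> \<bullet> (M *v \<xi> + w)) ` sphere 0 1)"
    by (intro compact_imp_bounded compact_continuous_image continuous_on_quad) auto
  then obtain B where "\<forall>y\<in>(\<lambda>\<xi>. \<xi> \<bullet> (M *v \<xi> + w)) ` sphere 0 1. norm y \<le> B"
    unfolding bounded_iff by blast
  then show ?thesis by (intro that[of B]) auto
qed

section \<open>Finite Borel measures on the sphere\<close>

lemma space_sphere_measure: "sets \<nu> = sets sphere_borel \<Longrightarrow> space \<nu> = sphere 0 1"
  by (drule sets_eq_imp_space_eq) (simp add: sphere_borel_def space_restrict_space)

lemma continuous_measurable_sphere:
  fixes f :: "real ^ 'n \<Rightarrow> real"
  assumes "sets \<nu> = sets sphere_borel" "continuous_on UNIV f"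
  shows "f \<in> borel_measurable \<nu>"
proof -
  have "f \<in> borel_measurable sphere_borel"
    unfolding sphere_borel_def
    by (intro measurable_restrict_space1 borel_measurable_continuous_onI assms)
  then show ?thesis using measurable_cong_sets[OF assms(1) refl] by blast
qed

lemma continuous_integrable_sphere:
  fixes f :: "real ^ 'n \<Rightarrow> real"
  assumes "finite_measure \<nu>" "sets \<nu> = sets sphere_borel" "continuous_on UNIV f"
  shows "integrable \<nu> f"
proof -
  interpret finite_measure \<nu> by fact
  have "bounded (f ` sphere 0 1)"
    by (intro compact_imp_bounded compact_continuous_image continuous_on_subset[OF assms(3)]) auto
  then obtain B where "\<And>\<xi>. \<xi> \<in> sphere 0 1 \<Longrightarrow> norm (f \<xi>) \<le> B"
    unfolding bounded_iff by blast
  then show ?thesis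
    using continuous_measurable_sphere[OF assms(2,3)]
    by (intro integrable_const_bound[where B = B]) (auto simp: space_sphere_measure[OF assms(2)])
qed

section \<open>The minimum of the functional\<close>

text \<open>The two inequalities come from the directions \<open>(H, v)\<close> and \<open>-(H, v)\<close>.\<close>

lemma euler_lagrange:
  fixes \<nu> :: "(real ^ 'n) measure" and M0 :: "real ^ 'n ^ 'n"
  assumes fin: "finite_measure \<nu>" and sets: "sets \<nu> = sets sphere_borel"
    and conv: "convex_on UNIV F"
    and der: "\<And>x. (F has_real_derivative F' x) (at x)"
    and cont: "continuous_on UNIV F'" and nonneg: "\<And>x. 0 \<le> F' x"
    and min: "is_arg_min (I_fun F \<nu>) (\<lambda>p. p \<in> Sym0 \<times> UNIV) (M0, w0)"
    and H: "H \<in> Sym0"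
  shows "(LINT \<xi>|\<nu>. F' (\<xi> \<bullet> (M0 *v \<xi> + w0)) * (\<xi> \<bullet> (H *v \<xi> + v))) = 0"
proof -
  have contF: "continuous_on UNIV F"
    using der by (meson DERIV_isCont continuous_at_imp_continuous_on)
  have ge: "0 \<le> (LINT \<xi>|\<nu>. F' (\<xi> \<bullet> (M0 *v \<xi> + w0)) * (\<xi> \<bullet> (H *v \<xi> + v)))"
    if H: "H \<in> Sym0" for H v
  proof -
    obtain A where A: "\<And>\<xi>. \<xi> \<in> sphere 0 1 \<Longrightarrow> \<bar>\<xi> \<bullet> (M0 *v \<xi> + w0)\<bar> \<le> A"
      using quad_bounded_on_sphere by blast
    obtain B where B: "\<And>\<xi>. \<xi> \<in> sphere 0 1 \<Longrightarrow> \<bar>\<xi> \<bullet> (H *v \<xi> + v)\<bar> \<le> B"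
      using quad_bounded_on_sphere by blast
    show ?thesis
    proof (rule integral_deriv_nonneg_of_convex_min[OF fin conv der cont nonneg, where A = A and B = B])
      fix t :: real
      show "integrable \<nu> (\<lambda>\<xi>. F (\<xi> \<bullet> (M0 *v \<xi> + w0) + t * (\<xi> \<bullet> (H *v \<xi> + v))))"
        using I_fun_integrable[OF fin sets contF, of "M0 + t *\<^sub>R H" "w0 + t *\<^sub>R v"]
        by (simp only: quad_add_scale)
      have "M0 \<in> Sym0" using min by (simp add: is_arg_min_def)
      then have "M0 + t *\<^sub>R H \<in> Sym0"
        using H subspace_Sym0 by (blast intro: subspace_add subspace_scale)
      then have "I_fun F \<nu> (M0, w0) \<le> I_fun F \<nu> (M0 + t *\<^sub>R H, w0 + t *\<^sub>R v)"
        using min by (force simp: is_arg_min_def not_less)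
      then show "(LINT \<xi>|\<nu>. F (\<xi> \<bullet> (M0 *v \<xi> + w0)))
          \<le> (LINT \<xi>|\<nu>. F (\<xi> \<bullet> (M0 *v \<xi> + w0) + t * (\<xi> \<bullet> (H *v \<xi> + v))))"
        by (simp only: I_fun_def split_conv quad_add_scale)
    qed (use A B space_sphere_measure[OF sets] in
        \<open>auto intro!: continuous_measurable_sphere[OF sets] continuous_on_quad\<close>)
  qed
  have "- H \<in> Sym0" using subspace_neg[OF subspace_Sym0 H] .
  from ge[OF this, of "- v"] have "0 \<le> (LINT \<xi>|\<nu>. - (F' (\<xi> \<bullet> (M0 *v \<xi> + w0)) * (\<xi> \<bullet> (H *v \<xi> + v))))"
    using quad_add_scale[of _ 0 "-1" H 0 v] by simp
  with ge[OF H, of v] show ?thesis by simp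
qed

text \<open>
  Otherwise \<open>F\<close> is constant to the left of almost all arguments \<open>\<xi> \<bullet> (M0 *v \<xi> + w0) < 0\<close>, and
  \<open>2 (M0, w0)\<close> is a further minimum.
\<close>

lemma not_AE_deriv_zero:
  fixes \<nu> :: "(real ^ 'n) measure" and M0 :: "real ^ 'n ^ 'n"
  assumes sets: "sets \<nu> = sets sphere_borel" and nz: "emeasure \<nu> (sphere 0 1) \<noteq> 0"
    and conv: "convex_on UNIV F" and mono: "mono F"
    and der: "\<And>x. (F has_real_derivative F' x) (at x)"
    and pos: "0 < F' 0"
    and min: "\<And>p. is_arg_min (I_fun F \<nu>) (\<lambda>p. p \<in> Sym0 \<times> UNIV) p \<longleftrightarrow> p = (M0, w0)"
  shows "\<not> (AE \<xi> in \<nu>. F' (\<xi> \<bullet> (M0 *v \<xi> + w0)) = 0)"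
proof
  assume zero: "AE \<xi> in \<nu>. F' (\<xi> \<bullet> (M0 *v \<xi> + w0)) = 0"
  have contF: "continuous_on UNIV F"
    using der by (meson DERIV_isCont continuous_at_imp_continuous_on)
  have double: "\<xi> \<bullet> ((2 *\<^sub>R M0) *v \<xi> + 2 *\<^sub>R w0) = 2 * (\<xi> \<bullet> (M0 *v \<xi> + w0))" for \<xi>
    using quad_add_scale[of \<xi> 0 2 M0 0 w0] by simp
  have "I_fun F \<nu> (2 *\<^sub>R M0, 2 *\<^sub>R w0) = I_fun F \<nu> (M0, w0)"
    unfolding I_fun_def split_conv
  proof (rule integral_cong_AE)
    show "AE \<xi> in \<nu>. F (\<xi> \<bullet> ((2 *\<^sub>R M0) *v \<xi> + 2 *\<^sub>R w0)) = F (\<xi> \<bullet> (M0 *v \<xi> + w0))"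
      using zero
    proof eventually_elim
      case (elim \<xi>)
      then have "\<xi> \<bullet> (M0 *v \<xi> + w0) < 0"
        using pos monoD[OF convex_deriv_mono[OF conv der], of 0 "\<xi> \<bullet> (M0 *v \<xi> + w0)"]
        by (cases "\<xi> \<bullet> (M0 *v \<xi> + w0) < 0") auto
      then show ?case
        unfolding double
        by (intro mono_convex_const_left_of_critical_point[OF conv der mono elim]) linarith
    qed
  qed (intro continuous_measurable_sphere[OF sets] continuous_on_compose2[OF contF]
        continuous_on_quad subset_UNIV)+
  moreover have "is_arg_min (I_fun F \<nu>) (\<lambda>p. p \<in> Sym0 \<times> UNIV) (M0, w0)"
    using min by blast
  moreover from this have "2 *\<^sub>R M0 \<in> Sym0"
    by (auto simp: is_arg_min_def intro: subspace_scale[OF subspace_Sym0])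
  ultimately have "is_arg_min (I_fun F \<nu>) (\<lambda>p. p \<in> Sym0 \<times> UNIV) (2 *\<^sub>R M0, 2 *\<^sub>R w0)"
    by (auto simp: is_arg_min_def)
  then have "(2 *\<^sub>R M0, 2 *\<^sub>R w0) = (M0, w0)"
    using min by blast
  then have "2 *\<^sub>R M0 - M0 = 0" "2 *\<^sub>R w0 - w0 = 0"
    by auto
  then have "M0 = 0" "w0 = 0"
    by (simp_all add: scaleR_2)
  then have "AE \<xi> in \<nu>. False"
    using zero pos by simp
  then have "emeasure \<nu> (space \<nu>) = 0"
    by (simp add: AE_iff_measurable[OF sets.top])
  with nz show False
    by (simp add: space_sphere_measure[OF sets])
qed

section \<open>Centeredness and isotropy\<close>

theorem theorem3:
  fixes K :: "(real ^ 'n) set"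
    and \<nu> :: "(real ^ 'n) measure"
    and F :: "real \<Rightarrow> real"
    and M0 :: "real ^ 'n ^ 'n"
    and w0 :: "real ^ 'n"
  assumes "convex_body K"
    and "lowner_position K"
    and "finite_measure \<nu>"
    and "sets \<nu> = sets sphere_borel"
    and "emeasure \<nu> (sphere 0 1 - frontier K) = 0"
    and "emeasure \<nu> (sphere 0 1) \<noteq> 0"
    and "F C1_differentiable_on UNIV"
    and "\<forall>t. F t \<ge> 0"
    and "mono F"
    and "convex_on UNIV F"
    and "strictly_convex_on {0..} F"
    and "deriv F 0 > 0"
    and "\<forall>p. is_arg_min (I_fun F \<nu>) (\<lambda>p. p \<in> Sym0 \<times> UNIV) p \<longleftrightarrow> p = (M0, w0)"
  shows "let \<mu> = density \<nu> (\<lambda>\<xi>. ennreal (deriv F (\<xi> \<bullet> (M0 *v \<xi> + w0))))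
         in (\<forall>\<xi>\<in>sphere 0 1. deriv F (\<xi> \<bullet> (M0 *v \<xi> + w0)) \<ge> 0) \<and>
            emeasure \<mu> (sphere 0 1) \<noteq> 0 \<and> centered \<mu> \<and> isotropic \<mu>"
proof -
  define g where "g = (\<lambda>\<xi>. deriv F (\<xi> \<bullet> (M0 *v \<xi> + w0)))"
  note fin = assms(3) and sets = assms(4)
  obtain D where D: "\<And>x. (F has_vector_derivative D x) (at x)" "continuous_on UNIV D"
    using assms(7) unfolding C1_differentiable_on_def by auto
  then have der': "(F has_real_derivative D x) (at x)" for x
    by (simp add: has_real_derivative_iff_has_vector_derivative)
  then have "deriv F = D"
    by (auto simp: fun_eq_iff intro: DERIV_imp_deriv)
  with der' D(2) have der: "\<And>x. (F has_real_derivative deriv F x) (at x)"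
    and contd: "continuous_on UNIV (deriv F)" by auto
  have nonneg: "0 \<le> deriv F x" for x
    using mono_on_imp_deriv_nonneg[of UNIV F "deriv F x" x] assms(9) der by auto
  have contg: "continuous_on UNIV g"
    unfolding g_def by (intro continuous_on_compose2[OF contd] continuous_on_quad subset_UNIV)
  have g_meas: "g \<in> borel_measurable \<nu>"
    using contg by (rule continuous_measurable_sphere[OF sets])
  have g0: "0 \<le> g \<xi>" for \<xi> by (simp add: g_def nonneg)
  have int: "integrable \<nu> (\<lambda>\<xi>. g \<xi> * f \<xi>)" if "continuous_on UNIV f" for f
    by (intro continuous_integrable_sphere[OF fin sets] continuous_on_mult contg that)
  have EL: "(LINT \<xi>|\<nu>. g \<xi> * (\<xi> \<bullet> (H *v \<xi> + v))) = 0" if "H \<in> Sym0" for H v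
    unfolding g_def using assms(13) that
    by (intro euler_lagrange[OF fin sets assms(10) der contd nonneg]) auto
  have not_zero: "\<not> (AE \<xi> in \<nu>. g \<xi> = 0)"
    unfolding g_def
    using not_AE_deriv_zero[OF sets assms(6,10,9) der assms(12)] assms(13) by blast

  define T where "T = (\<lambda>i j. LINT \<xi>|\<nu>. g \<xi> * (\<xi> $ i * \<xi> $ j))"
  have intT: "integrable \<nu> (\<lambda>\<xi>. g \<xi> * (\<xi> $ i * \<xi> $ j))" for i j
    by (intro int continuous_intros)
  have T_offdiag: "T i j = 0" if "i \<noteq> j" for i j
  proof -
    have "\<xi> \<bullet> ((tensor (axis i 1) (axis j 1) + tensor (axis j 1) (axis i 1)) *v \<xi> + 0) = 2 * (\<xi> $ i * \<xi> $ j)"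
      for \<xi> :: "real ^ 'n"
      by (simp add: matrix_vector_mult_add_rdistrib inner_add_right tensor_vector_mult inner_axis inner_axis')
    with EL[OF tensor_axis_Sym0(1)[OF that], of 0]
    have "(LINT \<xi>|\<nu>. 2 * (g \<xi> * (\<xi> $ i * \<xi> $ j))) = 0" by (simp add: mult_ac)
    then show ?thesis by (simp add: T_def)
  qed
  have T_diag: "T i i = T j j" for i j
  proof -
    have "\<xi> \<bullet> ((tensor (axis i 1) (axis i 1) - tensor (axis j 1) (axis j 1)) *v \<xi> + 0)
        = \<xi> $ i * \<xi> $ i - \<xi> $ j * \<xi> $ j" for \<xi> :: "real ^ 'n"
      by (simp add: matrix_vector_mult_diff_rdistrib inner_diff_right tensor_vector_mult inner_axis inner_axis')
    with EL[OF tensor_axis_Sym0(2)[of i j], of 0]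
    have "(LINT \<xi>|\<nu>. g \<xi> * (\<xi> $ i * \<xi> $ i) - g \<xi> * (\<xi> $ j * \<xi> $ j)) = 0"
      by (simp add: right_diff_distrib)
    then show ?thesis
      using intT by (simp add: T_def)
  qed
  \<comment> \<open>An arbitrary diagonal entry represents the common value of all of them.\<close>
  define c where "c = T undefined undefined"
  have "c \<noteq> 0"
  proof
    assume "c = 0"
    then have "0 = (\<Sum>i\<in>UNIV. T i i)"
      using T_diag[of _ undefined] by (simp add: c_def)
    also have "\<dots> = (LINT \<xi>|\<nu>. (\<Sum>i\<in>UNIV. g \<xi> * (\<xi> $ i * \<xi> $ i)))"
      using intT by (simp add: T_def)
    also have "\<dots> = (LINT \<xi>|\<nu>. g \<xi>)"
    proof (rule Bochner_Integration.integral_cong[OF refl])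
      fix \<xi> assume "\<xi> \<in> space \<nu>"
      then have "(\<Sum>i\<in>UNIV. \<xi> $ i * \<xi> $ i) = 1"
        using space_sphere_measure[OF sets] norm_eq_1[of \<xi>] by (simp add: inner_vec_def)
      then show "(\<Sum>i\<in>UNIV. g \<xi> * (\<xi> $ i * \<xi> $ i)) = g \<xi>"
        by (simp flip: sum_distrib_left)
    qed
    finally have "AE \<xi> in \<nu>. g \<xi> = 0"
      using integral_nonneg_eq_0_iff_AE[OF continuous_integrable_sphere[OF fin sets contg]] g0 by auto
    with not_zero show False ..
  qed
  have density: "has_bochner_integral (density \<nu> (\<lambda>\<xi>. ennreal (g \<xi>))) f x"
    if "continuous_on UNIV f" "(LINT \<xi>|\<nu>. g \<xi> * f \<xi>) = x" for f x
    using that g0 g_meas int[OF that(1)] continuous_measurable_sphere[OF sets that(1)]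
    by (intro has_bochner_integral_density) (auto simp: has_bochner_integral_iff)
  have "emeasure (density \<nu> (\<lambda>\<xi>. ennreal (g \<xi>))) (sphere 0 1) \<noteq> 0"
  proof
    assume *: "emeasure (density \<nu> (\<lambda>\<xi>. ennreal (g \<xi>))) (sphere 0 1) = 0"
    have "(\<integral>\<^sup>+ \<xi>. ennreal (g \<xi>) \<partial>\<nu>) = 0"
      using * g_meas by (simp add: space_sphere_measure[OF sets, symmetric] emeasure_density
          cong: nn_integral_cong)
    then have "AE \<xi> in \<nu>. g \<xi> = 0"
      using g_meas g0 by (simp add: nn_integral_0_iff_AE ennreal_eq_0_iff order_antisym_conv)
    with not_zero show False ..
  qed
  moreover have "centered (density \<nu> (\<lambda>\<xi>. ennreal (g \<xi>)))"
    unfolding centered_def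
  proof (intro allI density)
    show "(LINT \<xi>|\<nu>. g \<xi> * \<xi> $ i) = 0" for i
      using EL[OF subspace_0[OF subspace_Sym0], of "axis i 1"] by (simp add: inner_axis)
  qed (intro continuous_intros)
  moreover have "isotropic (density \<nu> (\<lambda>\<xi>. ennreal (g \<xi>)))"
    unfolding isotropic_def
  proof (intro exI[of _ c] conjI allI density)
    fix i j :: 'n
    show "(LINT \<xi>|\<nu>. g \<xi> * tensor \<xi> \<xi> $ i $ j) = (c *\<^sub>R (mat 1 :: real ^ 'n ^ 'n)) $ i $ j"
      using T_offdiag[of i j] T_diag[of i undefined]
      by (cases "i = j") (simp_all add: tensor_def mat_def c_def T_def)
    show "continuous_on UNIV (\<lambda>\<xi> :: real ^ 'n. tensor \<xi> \<xi> $ i $ j)"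
      by (simp add: tensor_def) (intro continuous_intros)
  qed fact
  ultimately show ?thesis
    using g0 unfolding g_def by (simp add: Let_def)
qed

end
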